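(* Let $(G,\precsim)$ be a C-quasi-ordered group and let $1\neq g\in G$ be v-type. The group $G_g$ is the smallest normal convex subgroup of $G^g$ such that the quotient $G^g/G_g$ (with the quasi-order induced by $\precsim$) is valuational.
   Context: A quasi-order is a reflexive, transitive and total binary relation $\precsim$; $a\sim b$ means $a\precsim b\precsim a$, and $a\precnsim b$ means $a\precsim b$ and $a\nsim b$. An element $c$ is between $a$ and $b$ if $a\precsim c\precsim b$ or $b\precsim c\precsim a$. A subset $S$ is convex if for all $s,t\in S$, $s\precsim a\precsim t$ implies $a\in S$. A C-relation on a set is a ternary relation $C$ such that for all $x,y,z,w$: $C(x,y,z)\Rightarrow C(x,z,y)$; $C(x,y,z)\Rightarrow\neg C(y,x,z)$; $C(x,y,z)\Rightarrow C(w,y,z)\vee C(x,w,z)$; $x\neq y\Rightarrow C(x,y,y)$. On a group it is compatible if $C(x,y,z)$ implies $C(vxu,vyu,vzu)$ for all $x,y,z,u,v$. A C-quasi-order on a group $G$ is a quasi-order of the form $x\precsim y\Leftrightarrow\neg C(x,y,1)$ with $C$ a compatible C-relation; a C-quasi-ordered group is a group with a C-quasi-order. With $g^z:=zgz^{-1}$, a valuation on a group is a map $v$ to $\Gamma\cup\{\infty\}$ ($\Gamma$ totally ordered, $\gamma<\infty$ for all $\gamma\in\Gamma$) with $v(g)=\infty\Leftrightarrow g=1$, $v(gh^{-1})\geq\min(v(g),v(h))$, $v(g)\leq v(h)\Leftrightarrow v(g^z)\leq v(h^z)$. A C-quasi-order is valuational if there is a valuation $v$ with $g\precsim h\Leftrightarrow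 v(g)\geq v(h)$. If $H$ is a convex normal subgroup of a C-quasi-ordered group $(K,\precsim)$, the C-quasi-order induced on $K/H$ is $aH\precsim bH\Leftrightarrow a\in H\vee(b\notin H\wedge a\precsim b)$. $g$ is v-type if $g\sim g^{-1}$; $o^+$-type if $g^{-1}\precnsim g$. For $g\neq1$ v-type, $T_g$ is the set of v-type elements $h\neq1$ such that there is no $o^+$-type element between $h$ and $g$; $G_g:=\{h\in G\mid h\precnsim t\text{ for all }t\in T_g\}$; $G^g:=G_g\cup T_g$. (Both $G_g$ and $G^g$ are subgroups of $G$.) *)

theory Defs
  imports "HOL-Algebra.Coset"
begin

text \<open>Relations are given as predicates on the type of elements; only their values on the carrier
  of the group matter.\<close>

definition quasi_order_on :: "'a set \<Rightarrow> ('a \<Rightarrow> 'a \<Rightarrow> bool) \<Rightarrow> bool" where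
  "quasi_order_on A qle \<longleftrightarrow> reflp_on A qle \<and> transp_on A qle \<and> totalp_on A qle"

definition qo_equiv :: "('a \<Rightarrow> 'a \<Rightarrow> bool) \<Rightarrow> 'a \<Rightarrow> 'a \<Rightarrow> bool" where
  "qo_equiv qle a b \<longleftrightarrow> qle a b \<and> qle b a"

definition qo_less :: "('a \<Rightarrow> 'a \<Rightarrow> bool) \<Rightarrow> 'a \<Rightarrow> 'a \<Rightarrow> bool" where
  "qo_less qle a b \<longleftrightarrow> qle a b \<and> \<not> qo_equiv qle a b"

definition between :: "('a \<Rightarrow> 'a \<Rightarrow> bool) \<Rightarrow> 'a \<Rightarrow> 'a \<Rightarrow> 'a \<Rightarrow> bool" where
  "between qle c a b \<longleftrightarrow> (qle a c \<and> qle c b) \<or> (qle b c \<and> qle c a)"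

definition convex_in :: "'a set \<Rightarrow> ('a \<Rightarrow> 'a \<Rightarrow> bool) \<Rightarrow> 'a set \<Rightarrow> bool" where
  "convex_in A qle S \<longleftrightarrow> S \<subseteq> A \<and> (\<forall>s\<in>S. \<forall>t\<in>S. \<forall>a\<in>A. qle s a \<and> qle a t \<longrightarrow> a \<in> S)"

definition C_relation_on :: "'a set \<Rightarrow> ('a \<Rightarrow> 'a \<Rightarrow> 'a \<Rightarrow> bool) \<Rightarrow> bool" where
  "C_relation_on A C \<longleftrightarrow>
     (\<forall>x\<in>A. \<forall>y\<in>A. \<forall>z\<in>A. C x y z \<longrightarrow> C x z y) \<and>
     (\<forall>x\<in>A. \<forall>y\<in>A. \<forall>z\<in>A. C x y z \<longrightarrow> \<not> C y x z) \<and>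
     (\<forall>x\<in>A. \<forall>y\<in>A. \<forall>z\<in>A. \<forall>w\<in>A. C x y z \<longrightarrow> C w y z \<or> C x w z) \<and>
     (\<forall>x\<in>A. \<forall>y\<in>A. x \<noteq> y \<longrightarrow> C x y y)"

definition compatible_C :: "('a, 'm) monoid_scheme \<Rightarrow> ('a \<Rightarrow> 'a \<Rightarrow> 'a \<Rightarrow> bool) \<Rightarrow> bool" where
  "compatible_C G C \<longleftrightarrow>
     (\<forall>x\<in>carrier G. \<forall>y\<in>carrier G. \<forall>z\<in>carrier G. \<forall>u\<in>carrier G. \<forall>v\<in>carrier G.
        C x y z \<longrightarrow> C (v \<otimes>\<^bsub>G\<^esub> x \<otimes>\<^bsub>G\<^esub> u) (v \<otimes>\<^bsub>G\<^esub> y \<otimes>\<^bsub>G\<^esub> u) (v \<otimes>\<^bsub>G\<^esub> z \<otimes>\<^bsub>G\<^esub> u))"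

definition C_quasi_order :: "('a, 'm) monoid_scheme \<Rightarrow> ('a \<Rightarrow> 'a \<Rightarrow> bool) \<Rightarrow> bool" where
  "C_quasi_order G qle \<longleftrightarrow> quasi_order_on (carrier G) qle \<and>
     (\<exists>C. C_relation_on (carrier G) C \<and> compatible_C G C \<and>
          (\<forall>x\<in>carrier G. \<forall>y\<in>carrier G. qle x y \<longleftrightarrow> \<not> C x y \<one>\<^bsub>G\<^esub>))"

definition C_quasi_ordered_group :: "('a, 'm) monoid_scheme \<Rightarrow> ('a \<Rightarrow> 'a \<Rightarrow> bool) \<Rightarrow> bool" where
  "C_quasi_ordered_group G qle \<longleftrightarrow> group G \<and> C_quasi_order G qle"

definition conj_by :: "('a, 'm) monoid_scheme \<Rightarrow> 'a \<Rightarrow> 'a \<Rightarrow> 'a" where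
  "conj_by G g z = z \<otimes>\<^bsub>G\<^esub> g \<otimes>\<^bsub>G\<^esub> inv\<^bsub>G\<^esub> z"

text \<open>A value in \<open>\<Gamma> \<union> {\<infinity>}\<close> is an option, \<open>None\<close> being \<open>\<infinity>\<close>; \<open>r\<close> is the
  (non-strict) order of \<open>\<Gamma>\<close>.\<close>

definition val_le :: "('v \<times> 'v) set \<Rightarrow> 'v option \<Rightarrow> 'v option \<Rightarrow> bool" where
  "val_le r x y \<longleftrightarrow> y = None \<or> (\<exists>a b. x = Some a \<and> y = Some b \<and> (a, b) \<in> r)"

definition val_min :: "('v \<times> 'v) set \<Rightarrow> 'v option \<Rightarrow> 'v option \<Rightarrow> 'v option" where
  "val_min r x y = (if val_le r x y then x else y)"

definition valuation ::
  "('a, 'm) monoid_scheme \<Rightarrow> 'v set \<Rightarrow> ('v \<times> 'v) set \<Rightarrow> ('a \<Rightarrow> 'v option) \<Rightarrow> bool" where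
  "valuation G \<Gamma> r v \<longleftrightarrow> linear_order_on \<Gamma> r \<and>
     (\<forall>g\<in>carrier G. v g \<in> insert None (Some ` \<Gamma>)) \<and>
     (\<forall>g\<in>carrier G. v g = None \<longleftrightarrow> g = \<one>\<^bsub>G\<^esub>) \<and>
     (\<forall>g\<in>carrier G. \<forall>h\<in>carrier G.
        val_le r (val_min r (v g) (v h)) (v (g \<otimes>\<^bsub>G\<^esub> inv\<^bsub>G\<^esub> h))) \<and>
     (\<forall>g\<in>carrier G. \<forall>h\<in>carrier G. \<forall>z\<in>carrier G.
        val_le r (v g) (v h) \<longleftrightarrow> val_le r (v (conj_by G g z)) (v (conj_by G h z)))"

definition induced_by_valuation ::
  "('a, 'm) monoid_scheme \<Rightarrow> ('v \<times> 'v) set \<Rightarrow> ('a \<Rightarrow> 'v option) \<Rightarrow> ('a \<Rightarrow> 'a \<Rightarrow> bool) \<Rightarrow> bool" where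
  "induced_by_valuation G r v qle \<longleftrightarrow>
     (\<forall>g\<in>carrier G. \<forall>h\<in>carrier G. qle g h \<longleftrightarrow> val_le r (v h) (v g))"

text \<open>HOL cannot quantify over the type of values inside a formula, so \<open>\<Gamma>\<close> ranges over the
  linearly ordered sets of elements of the type of \<open>G\<close>. This is no restriction, by
  \<open>valuationalI\<close> below.\<close>

definition valuational :: "('a, 'm) monoid_scheme \<Rightarrow> ('a \<Rightarrow> 'a \<Rightarrow> bool) \<Rightarrow> bool" where
  "valuational G qle \<longleftrightarrow> C_quasi_ordered_group G qle \<and>
     (\<exists>(\<Gamma> :: 'a set) r v. valuation G \<Gamma> r v \<and> induced_by_valuation G r v qle)"

lemma valuationalI:
  fixes \<Gamma> :: "'v set" and G :: "('a, 'm) monoid_scheme"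
  assumes cqo: "C_quasi_ordered_group G qle"
    and val: "valuation G \<Gamma> r v" and ind: "induced_by_valuation G r v qle"
  shows "valuational G qle"
proof -
  interpret group G using cqo by (simp add: C_quasi_ordered_group_def)
  define I where "I = {c. \<exists>g\<in>carrier G. v g = Some c}"
  define f where "f c = (SOME g. g \<in> carrier G \<and> v g = Some c)" for c
  have f: "v (f c) = Some c" if "c \<in> I" for c
    using that someI_ex[of "\<lambda>g. g \<in> carrier G \<and> v g = Some c"] unfolding I_def f_def by blast
  have inj: "f a = f b \<longleftrightarrow> a = b" if "a \<in> I" "b \<in> I" for a b
    using f[OF that(1)] f[OF that(2)] by (metis option.inject)
  define r' where "r' = {(f a, f b) |a b. a \<in> I \<and> b \<in> I \<and> (a, b) \<in> r}"
  define v' where "v' g = map_option f (v g)" for g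
  have r': "(f a, f b) \<in> r' \<longleftrightarrow> (a, b) \<in> r" if "a \<in> I" "b \<in> I" for a b
    using that inj unfolding r'_def by blast
  have qle: "val_le r' (v' g) (v' h) \<longleftrightarrow> val_le r (v g) (v h)"
    if "g \<in> carrier G" "h \<in> carrier G" for g h
    using that r' unfolding val_le_def v'_def I_def by (cases "v g"; cases "v h") auto
  have rI: "I \<subseteq> \<Gamma>" using val unfolding valuation_def I_def by fastforce
  have lr: "linear_order_on \<Gamma> r" using val by (simp add: valuation_def)
  have lin: "linear_order_on (f ` I) r'"
    unfolding linear_order_on_def partial_order_on_def preorder_on_def
  proof (intro conjI)
    have \<Gamma>: "refl_on \<Gamma> r" "trans r" "antisym r" "total_on \<Gamma> r"
      using lr unfolding linear_order_on_def partial_order_on_def preorder_on_def by auto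
    show "r' \<subseteq> f ` I \<times> f ` I" by (auto simp: r'_def)
    show "refl_on (f ` I) r'" using \<Gamma>(1) rI r' unfolding refl_on_def by blast
    show "trans r'"
    proof (rule transI)
      fix x y z assume "(x, y) \<in> r'" "(y, z) \<in> r'"
      then obtain a b b' c where *: "x = f a" "y = f b" "y = f b'" "z = f c"
        "a \<in> I" "b \<in> I" "b' \<in> I" "c \<in> I" "(a, b) \<in> r" "(b', c) \<in> r"
        unfolding r'_def by blast
      then have "b = b'" using inj by metis
      then have "(a, c) \<in> r" using * \<Gamma>(2) by (meson transD)
      then show "(x, z) \<in> r'" using * r' by simp
    qed
    show "antisym r'"
    proof (rule antisymI)
      fix x y assume xy: "(x, y) \<in> r'" "(y, x) \<in> r'"
      then obtain a b where *: "x = f a" "y = f b" "a \<in> I" "b \<in> I" unfolding r'_def by blast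
      then have "(a, b) \<in> r" "(b, a) \<in> r" using xy r' by simp_all
      then show "x = y" using * \<Gamma>(3) by (metis antisymD)
    qed
    show "total_on (f ` I) r'"
    proof (rule total_onI)
      fix x y assume "x \<in> f ` I" "y \<in> f ` I" "x \<noteq> y"
      then obtain a b where *: "x = f a" "y = f b" "a \<in> I" "b \<in> I" by blast
      with \<open>x \<noteq> y\<close> have "(a, b) \<in> r \<or> (b, a) \<in> r"
        using \<Gamma>(4) rI unfolding total_on_def by (metis subsetD)
      then show "(x, y) \<in> r' \<or> (y, x) \<in> r'" using * r' by simp
    qed
  qed
  have mn: "val_le r' (val_min r' (v' g) (v' h)) (v' (g \<otimes>\<^bsub>G\<^esub> inv\<^bsub>G\<^esub> h))"
    if "g \<in> carrier G" "h \<in> carrier G" for g h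
  proof -
    have "val_le r (val_min r (v g) (v h)) (v (g \<otimes>\<^bsub>G\<^esub> inv\<^bsub>G\<^esub> h))"
      using val that unfolding valuation_def by blast
    then show ?thesis using that by (cases "val_le r (v g) (v h)") (simp_all add: val_min_def qle)
  qed
  have "valuation G (f ` I) r' v'"
    unfolding valuation_def
  proof (intro conjI ballI)
    show "v' g \<in> insert None (Some ` f ` I)" if "g \<in> carrier G" for g
      using that unfolding v'_def I_def by (cases "v g") auto
    show "v' g = None \<longleftrightarrow> g = \<one>\<^bsub>G\<^esub>" if "g \<in> carrier G" for g
      using that val unfolding v'_def valuation_def by auto
    show "val_le r' (v' g) (v' h) \<longleftrightarrow> val_le r' (v' (conj_by G g z)) (v' (conj_by G h z))"
      if "g \<in> carrier G" "h \<in> carrier G" "z \<in> carrier G" for g h z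
    proof -
      have "conj_by G g z \<in> carrier G" "conj_by G h z \<in> carrier G"
        using that by (simp_all add: conj_by_def)
      moreover have "val_le r (v g) (v h) \<longleftrightarrow> val_le r (v (conj_by G g z)) (v (conj_by G h z))"
        using val that unfolding valuation_def by blast
      ultimately show ?thesis using that by (simp add: qle)
    qed
  qed (use lin mn in auto)
  moreover have "induced_by_valuation G r' v' qle"
    using ind by (simp add: induced_by_valuation_def qle)
  ultimately show ?thesis using cqo unfolding valuational_def by blast
qed

text \<open>The relation induced on \<open>K Mod H\<close>. It does not depend on the choice of representatives, by
  \<open>quotient_le_coset\<close> below.\<close>

definition quotient_le ::
  "('a, 'm) monoid_scheme \<Rightarrow> ('a \<Rightarrow> 'a \<Rightarrow> bool) \<Rightarrow> 'a set \<Rightarrow> 'a set \<Rightarrow> 'a set \<Rightarrow> bool" where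
  "quotient_le K qle H A B \<longleftrightarrow>
     (\<exists>a\<in>carrier K. \<exists>b\<in>carrier K. A = a <#\<^bsub>K\<^esub> H \<and> B = b <#\<^bsub>K\<^esub> H \<and>
        (a \<in> H \<or> (b \<notin> H \<and> qle a b)))"

lemma C_quasi_order_mult_convex:
  assumes cqo: "C_quasi_ordered_group K qle" and sub: "subgroup H K"
    and conv: "convex_in (carrier K) qle H"
    and a: "a \<in> carrier K" "a \<notin> H" and h: "h \<in> H"
  shows "qle (a \<otimes>\<^bsub>K\<^esub> h) a" "qle a (a \<otimes>\<^bsub>K\<^esub> h)"
proof -
  interpret group K using cqo by (simp add: C_quasi_ordered_group_def)
  interpret H: subgroup H K by (rule sub)
  obtain C where C: "C_relation_on (carrier K) C" "compatible_C K C"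
    and qle: "\<And>x y. x \<in> carrier K \<Longrightarrow> y \<in> carrier K \<Longrightarrow> qle x y \<longleftrightarrow> \<not> C x y \<one>\<^bsub>K\<^esub>"
    and qo: "quasi_order_on (carrier K) qle"
    using cqo unfolding C_quasi_ordered_group_def C_quasi_order_def by auto
  have tot: "qle x y \<or> qle y x" if "x \<in> carrier K" "y \<in> carrier K" for x y
    using qo that unfolding quasi_order_on_def totalp_on_def reflp_on_def by metis
  have swap: "C x z y" if "C x y z" "x \<in> carrier K" "y \<in> carrier K" "z \<in> carrier K" for x y z
    using C(1) that unfolding C_relation_on_def by blast
  have asym: "\<not> C y x z" if "C x y z" "x \<in> carrier K" "y \<in> carrier K" "z \<in> carrier K" for x y z
    using C(1) that unfolding C_relation_on_def by blast
  have mul: "C (v \<otimes>\<^bsub>K\<^esub> x \<otimes>\<^bsub>K\<^esub> u) (v \<otimes>\<^bsub>K\<^esub> y \<otimes>\<^bsub>K\<^esub> u) (v \<otimes>\<^bsub>K\<^esub> z \<otimes>\<^bsub>K\<^esub> u)"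
    if "C x y z" "x \<in> carrier K" "y \<in> carrier K" "z \<in> carrier K" "u \<in> carrier K" "v \<in> carrier K"
    for x y z u v using C(2) that unfolding compatible_C_def by blast
  have one_le: "qle \<one>\<^bsub>K\<^esub> x" if x: "x \<in> carrier K" for x
  proof (rule ccontr)
    assume "\<not> ?thesis"
    then have "C \<one>\<^bsub>K\<^esub> x \<one>\<^bsub>K\<^esub>" using qle x by simp
    from swap[OF this] asym[OF swap[OF this]] x show False by simp
  qed
  have below: "x \<in> H" if "C s x \<one>\<^bsub>K\<^esub>" "s \<in> H" "x \<in> carrier K" for s x
  proof -
    have "s \<in> carrier K" using that(2) by simp
    then have "qle x s" using that tot qle by blast
    then show ?thesis
      using conv that(2,3) one_le[OF that(3)] H.one_closed unfolding convex_in_def by blast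
  qed
  have hc: "h \<in> carrier K" using h by simp
  show "qle (a \<otimes>\<^bsub>K\<^esub> h) a"
  proof (rule ccontr)
    assume "\<not> qle (a \<otimes>\<^bsub>K\<^esub> h) a"
    then have "C (a \<otimes>\<^bsub>K\<^esub> h) a \<one>\<^bsub>K\<^esub>" using qle a(1) hc by simp
    then have "C h \<one>\<^bsub>K\<^esub> (inv\<^bsub>K\<^esub> a)"
      using mul[of "a \<otimes>\<^bsub>K\<^esub> h" a "\<one>\<^bsub>K\<^esub>" "\<one>\<^bsub>K\<^esub>" "inv\<^bsub>K\<^esub> a"] a(1) hc by (simp add: m_assoc[symmetric])
    then have "inv\<^bsub>K\<^esub> a \<in> H" using below[of h "inv\<^bsub>K\<^esub> a"] swap a(1) h by simp
    then have "inv\<^bsub>K\<^esub> (inv\<^bsub>K\<^esub> a) \<in> H" by (rule H.m_inv_closed)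
    then show False using a by simp
  qed
  show "qle a (a \<otimes>\<^bsub>K\<^esub> h)"
  proof (rule ccontr)
    assume "\<not> qle a (a \<otimes>\<^bsub>K\<^esub> h)"
    then have "C a (a \<otimes>\<^bsub>K\<^esub> h) \<one>\<^bsub>K\<^esub>" using qle a(1) hc by simp
    then have "C (inv\<^bsub>K\<^esub> h) \<one>\<^bsub>K\<^esub> (inv\<^bsub>K\<^esub> a \<otimes>\<^bsub>K\<^esub> inv\<^bsub>K\<^esub> h)"
      using mul[of a "a \<otimes>\<^bsub>K\<^esub> h" "\<one>\<^bsub>K\<^esub>" "inv\<^bsub>K\<^esub> h" "inv\<^bsub>K\<^esub> a"] a(1) hc by (simp add: m_assoc[symmetric])
    then have "inv\<^bsub>K\<^esub> a \<otimes>\<^bsub>K\<^esub> inv\<^bsub>K\<^esub> h \<in> H"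
      using below[of "inv\<^bsub>K\<^esub> h" "inv\<^bsub>K\<^esub> a \<otimes>\<^bsub>K\<^esub> inv\<^bsub>K\<^esub> h"] swap a(1) h by simp
    then have "inv\<^bsub>K\<^esub> a \<otimes>\<^bsub>K\<^esub> inv\<^bsub>K\<^esub> h \<otimes>\<^bsub>K\<^esub> h \<in> H" using h by simp
    then have "inv\<^bsub>K\<^esub> a \<in> H" using a(1) hc by (simp add: m_assoc)
    then have "inv\<^bsub>K\<^esub> (inv\<^bsub>K\<^esub> a) \<in> H" by (rule H.m_inv_closed)
    then show False using a by simp
  qed
qed

lemma quotient_le_coset:
  assumes cqo: "C_quasi_ordered_group K qle" and sub: "subgroup H K"
    and conv: "convex_in (carrier K) qle H"
    and a: "a \<in> carrier K" and b: "b \<in> carrier K"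
  shows "quotient_le K qle H (a <#\<^bsub>K\<^esub> H) (b <#\<^bsub>K\<^esub> H) \<longleftrightarrow> a \<in> H \<or> (b \<notin> H \<and> qle a b)"
proof
  assume "quotient_le K qle H (a <#\<^bsub>K\<^esub> H) (b <#\<^bsub>K\<^esub> H)"
  then obtain c d where cd: "c \<in> carrier K" "d \<in> carrier K"
    and eq: "a <#\<^bsub>K\<^esub> H = c <#\<^bsub>K\<^esub> H" "b <#\<^bsub>K\<^esub> H = d <#\<^bsub>K\<^esub> H"
    and qle: "c \<in> H \<or> (d \<notin> H \<and> qle c d)"
    unfolding quotient_le_def by blast
  interpret group K using cqo by (simp add: C_quasi_ordered_group_def)
  interpret H: subgroup H K by (rule sub)
  have tr: "transp_on (carrier K) qle"
    using cqo unfolding C_quasi_ordered_group_def C_quasi_order_def quasi_order_on_def by blast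
  have rep: "\<exists>h\<in>H. x = y \<otimes>\<^bsub>K\<^esub> h" if "x <#\<^bsub>K\<^esub> H = y <#\<^bsub>K\<^esub> H" "x \<in> carrier K" for x y
  proof -
    have "x \<in> x <#\<^bsub>K\<^esub> H" using that(2) unfolding l_coset_def by force
    then show ?thesis using that(1) unfolding l_coset_def by auto
  qed
  obtain h where h: "h \<in> H" "a = c \<otimes>\<^bsub>K\<^esub> h" using rep[OF eq(1) a] by blast
  obtain k where k: "k \<in> H" "d = b \<otimes>\<^bsub>K\<^esub> k" using rep[OF eq(2)[symmetric] cd(2)] by blast
  show "a \<in> H \<or> (b \<notin> H \<and> qle a b)"
  proof (cases "c \<in> H")
    case True
    then show ?thesis using h by simp
  next
    case False
    then have d: "d \<notin> H" and "qle c d" using qle by auto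
    have b': "b \<notin> H" using d k by auto
    have "qle a c" using C_quasi_order_mult_convex(1)[OF cqo sub conv cd(1) False h(1)] h(2) by simp
    moreover have "qle d b"
      using C_quasi_order_mult_convex(1)[OF cqo sub conv b b' k(1)] k(2) by simp
    ultimately have "qle a b" using tr \<open>qle c d\<close> a b cd unfolding transp_on_def by meson
    then show ?thesis using b' by simp
  qed
next
  assume "a \<in> H \<or> (b \<notin> H \<and> qle a b)"
  then show "quotient_le K qle H (a <#\<^bsub>K\<^esub> H) (b <#\<^bsub>K\<^esub> H)"
    using a b unfolding quotient_le_def by blast
qed

definition v_type :: "('a, 'm) monoid_scheme \<Rightarrow> ('a \<Rightarrow> 'a \<Rightarrow> bool) \<Rightarrow> 'a \<Rightarrow> bool" where
  "v_type G qle g \<longleftrightarrow> qo_equiv qle g (inv\<^bsub>G\<^esub> g)"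

definition o_plus_type :: "('a, 'm) monoid_scheme \<Rightarrow> ('a \<Rightarrow> 'a \<Rightarrow> bool) \<Rightarrow> 'a \<Rightarrow> bool" where
  "o_plus_type G qle g \<longleftrightarrow> qo_less qle (inv\<^bsub>G\<^esub> g) g"

text \<open>\<open>T_set G qle g\<close>, \<open>lower_group G qle g\<close> and \<open>upper_group G qle g\<close> are
  \<open>T\<^sub>g\<close>, \<open>G\<^sub>g\<close> and \<open>G\<^sup>g\<close>.\<close>

definition T_set :: "('a, 'm) monoid_scheme \<Rightarrow> ('a \<Rightarrow> 'a \<Rightarrow> bool) \<Rightarrow> 'a \<Rightarrow> 'a set" where
  "T_set G qle g = {h \<in> carrier G. h \<noteq> \<one>\<^bsub>G\<^esub> \<and> v_type G qle h \<and>
     \<not> (\<exists>c\<in>carrier G. o_plus_type G qle c \<and> between qle c h g)}"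

definition lower_group :: "('a, 'm) monoid_scheme \<Rightarrow> ('a \<Rightarrow> 'a \<Rightarrow> bool) \<Rightarrow> 'a \<Rightarrow> 'a set" where
  "lower_group G qle g = {h \<in> carrier G. \<forall>t\<in>T_set G qle g. qo_less qle h t}"

definition upper_group :: "('a, 'm) monoid_scheme \<Rightarrow> ('a \<Rightarrow> 'a \<Rightarrow> bool) \<Rightarrow> 'a \<Rightarrow> 'a set" where
  "upper_group G qle g = lower_group G qle g \<union> T_set G qle g"

definition normal_convex_valuational ::
  "('a, 'm) monoid_scheme \<Rightarrow> ('a \<Rightarrow> 'a \<Rightarrow> bool) \<Rightarrow> 'a set \<Rightarrow> bool" where
  "normal_convex_valuational K qle N \<longleftrightarrow>
     N \<lhd> K \<and> convex_in (carrier K) qle N \<and> valuational (K Mod N) (quotient_le K qle N)"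

end

theory Submission
  imports Defs
begin

text \<open>Writing \<open>C(x, y, z)\<close> as \<open>y z\<^sup>-\<^sup>1 \<prec> x z\<^sup>-\<^sup>1\<close> turns the axioms of a compatible C-relation into
  \<open>1 \<prec> x\<close> for \<open>x \<noteq> 1\<close>, invariance under conjugation, and \<open>x y \<lesssim> x \<longleftrightarrow> y \<lesssim> x\<^sup>-\<^sup>1\<close>. If \<open>t\<close> is
  v-type, it is neither equivalent to an \<open>o\<^sup>+\<close>-type element nor strictly between an element and its
  inverse, and the elements strictly below \<open>t\<close> form a group; \<open>G\<^sub>g\<close> is the intersection of these
  groups over \<open>T\<^sub>g\<close>. Were \<open>a t a\<^sup>-\<^sup>1 \<in> G\<^sub>g\<close> with \<open>a, t \<in> T\<^sub>g\<close>, an \<open>o\<^sup>+\<close>-type element of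
  \<open>G\<^sub>g\<close> above it would be conjugated by \<open>a\<^sup>-\<^sup>1\<close> between \<open>t\<close> and \<open>a\<close>; hence \<open>G\<^sub>g\<close> is normal in \<open>G\<^sup>g\<close>.
  A C-quasi-order is valuational iff all elements are v-type. So a subgroup with valuational quotient
  contains all \<open>o\<^sup>+\<close>-type elements, and each v-type element \<open>\<noteq> 1\<close> of \<open>G\<^sub>g\<close> lies below an
  \<open>o\<^sup>+\<close>-type element of \<open>G\<^sub>g\<close>, as it is not in \<open>T\<^sub>g\<close>.\<close>

section \<open>Inequalities for products and inverses from the order axioms\<close>

locale C_qo_group = group G for G (structure) +
  fixes le :: "'a \<Rightarrow> 'a \<Rightarrow> bool" (infix "\<lesssim>" 50)
  assumes le_total: "x \<in> carrier G \<Longrightarrow> y \<in> carrier G \<Longrightarrow> x \<lesssim> y \<or> y \<lesssim> x"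
    and le_trans: "x \<lesssim> y \<Longrightarrow> y \<lesssim> z \<Longrightarrow> x \<in> carrier G \<Longrightarrow> y \<in> carrier G \<Longrightarrow> z \<in> carrier G
      \<Longrightarrow> x \<lesssim> z"
    and le_one_iff: "x \<in> carrier G \<Longrightarrow> x \<lesssim> \<one> \<longleftrightarrow> x = \<one>"
    and mult_le_left_iff: "x \<in> carrier G \<Longrightarrow> y \<in> carrier G \<Longrightarrow> x \<otimes> y \<lesssim> x \<longleftrightarrow> y \<lesssim> inv x"
    and conj_mono: "x \<lesssim> y \<Longrightarrow> x \<in> carrier G \<Longrightarrow> y \<in> carrier G \<Longrightarrow> z \<in> carrier G
      \<Longrightarrow> z \<otimes> x \<otimes> inv z \<lesssim> z \<otimes> y \<otimes> inv z"
begin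

lemma le_refl: "x \<in> carrier G \<Longrightarrow> x \<lesssim> x"
  using le_total by blast

lemma one_le: "x \<in> carrier G \<Longrightarrow> \<one> \<lesssim> x"
  using le_total le_one_iff le_refl one_closed by metis

lemma conj_le_iff:
  assumes "x \<in> carrier G" "y \<in> carrier G" "z \<in> carrier G"
  shows "z \<otimes> x \<otimes> inv z \<lesssim> z \<otimes> y \<otimes> inv z \<longleftrightarrow> x \<lesssim> y"
proof
  have eq: "inv z \<otimes> (z \<otimes> w \<otimes> inv z) \<otimes> inv (inv z) = w" if "w \<in> carrier G" for w
    using assms(3) that by (simp add: m_assoc) (simp add: m_assoc[symmetric])
  assume "z \<otimes> x \<otimes> inv z \<lesssim> z \<otimes> y \<otimes> inv z"
  then have "inv z \<otimes> (z \<otimes> x \<otimes> inv z) \<otimes> inv (inv z) \<lesssim> inv z \<otimes> (z \<otimes> y \<otimes> inv z) \<otimes> inv (inv z)"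
    by (rule conj_mono) (use assms in auto)
  then show "x \<lesssim> y" using eq assms by simp
qed (rule conj_mono, use assms in auto)

text \<open>Conjugation by \<open>x\<close> takes \<open>y \<otimes> x\<close> to
  \<open>x \<otimes> y\<close> and fixes \<open>x\<close>, which reduces this to
  \<open>mult_le_left_iff\<close>.\<close>

lemma mult_le_right_iff:
  assumes "x \<in> carrier G" "y \<in> carrier G"
  shows "y \<otimes> x \<lesssim> x \<longleftrightarrow> y \<lesssim> inv x"
proof -
  have "x \<otimes> (y \<otimes> x) \<otimes> inv x = x \<otimes> y" "x \<otimes> x \<otimes> inv x = x"
    using assms by (simp_all add: m_assoc)
  then show ?thesis
    using conj_le_iff[of "y \<otimes> x" x x] mult_le_left_iff assms by simp
qed

text \<open>Both parts are instances of \<open>mult_le_left_iff\<close>, the second after reading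
  \<open>y\<close> as \<open>(y \<otimes> x) \<otimes> inv x\<close>. This is the ultrametric
  principle that a small enough factor does not change the class of a product.\<close>

lemma mult_equiv_left:
  assumes "x \<in> carrier G" "y \<in> carrier G" "\<not> inv y \<lesssim> x"
  shows "y \<otimes> x \<lesssim> y" "y \<lesssim> y \<otimes> x"
proof -
  have "x \<lesssim> inv y" using assms le_total by blast
  then show "y \<otimes> x \<lesssim> y" using assms mult_le_left_iff by simp
  have "\<not> inv x \<otimes> inv y \<lesssim> inv x"
    using assms mult_le_left_iff[of "inv x" "inv y"] by simp
  then have "inv x \<lesssim> inv (y \<otimes> x)"
    using assms le_total[of "inv x" "inv x \<otimes> inv y"] by (simp add: inv_mult_group)
  then have "(y \<otimes> x) \<otimes> inv x \<lesssim> y \<otimes> x"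
    using assms mult_le_left_iff[of "y \<otimes> x" "inv x"] by simp
  then show "y \<lesssim> y \<otimes> x" using assms by (simp add: m_assoc)
qed

lemma mult_equiv_right:
  assumes "x \<in> carrier G" "y \<in> carrier G" "\<not> inv y \<lesssim> x"
  shows "x \<otimes> y \<lesssim> y" "y \<lesssim> x \<otimes> y"
proof -
  have "y \<otimes> (x \<otimes> y) \<otimes> inv y = y \<otimes> x" "y \<otimes> y \<otimes> inv y = y"
    using assms by (simp_all add: m_assoc)
  then show "x \<otimes> y \<lesssim> y" "y \<lesssim> x \<otimes> y"
    using conj_le_iff[of "x \<otimes> y" y y] conj_le_iff[of y "x \<otimes> y" y] mult_equiv_left[OF assms] assms
    by simp_all
qed

text \<open>In terms of the C-relation: \<open>b\<close> branches off \<open>{a, \<one>}\<close> and \<open>a\<close> does not separate from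
  \<open>\<one>\<close> below \<open>t\<close>, so \<open>b\<close> also branches off \<open>{a, t}\<close>; translating \<open>t\<close> to \<open>\<one>\<close> gives the claim.\<close>

lemma mult_strict_mono_left:
  assumes "inv t \<lesssim> a" "\<not> b \<lesssim> a" "a \<in> carrier G" "b \<in> carrier G" "t \<in> carrier G"
  shows "\<not> t \<otimes> b \<lesssim> t \<otimes> a"
proof
  assume "t \<otimes> b \<lesssim> t \<otimes> a"
  \<comment> \<open>As a right multiple of \<open>t \<otimes> a\<close>, the product can be compared
    by \<open>mult_le_left_iff\<close>. The chain \<open>inv a \<otimes> b \<lesssim> inv a
    \<otimes> inv t \<lesssim> inv a\<close> then forces \<open>b \<lesssim> a\<close>.\<close>
  moreover have "t \<otimes> b = (t \<otimes> a) \<otimes> (inv a \<otimes> b)"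
    using assms by (simp add: m_assoc) (simp add: m_assoc[symmetric])
  ultimately have 1: "inv a \<otimes> b \<lesssim> inv a \<otimes> inv t"
    using assms mult_le_left_iff[of "t \<otimes> a" "inv a \<otimes> b"] by (simp add: inv_mult_group)
  have "inv a \<otimes> inv t \<lesssim> inv a" using assms mult_le_left_iff[of "inv a" "inv t"] by simp
  with 1 have "inv a \<otimes> b \<lesssim> inv a" by (rule le_trans) (use assms in auto)
  then show False using assms mult_le_left_iff[of "inv a" b] by simp
qed

section \<open>Types of elements, and v-type elements as bounds\<close>

lemma v_type_iff: "v_type G le x \<longleftrightarrow> x \<lesssim> inv x \<and> inv x \<lesssim> x"
  by (simp add: v_type_def qo_equiv_def)

lemma o_plus_iff: "x \<in> carrier G \<Longrightarrow> o_plus_type G le x \<longleftrightarrow> \<not> x \<lesssim> inv x"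
  using le_total[of x "inv x"] by (auto simp: o_plus_type_def qo_less_def qo_equiv_def)

lemma qo_less_iff: "x \<in> carrier G \<Longrightarrow> y \<in> carrier G \<Longrightarrow> qo_less le x y \<longleftrightarrow> \<not> y \<lesssim> x"
  using le_total[of x y] by (auto simp: qo_less_def qo_equiv_def)

lemma type_cases:
  assumes "x \<in> carrier G"
  obtains "v_type G le x" | "o_plus_type G le x" | "o_plus_type G le (inv x)"
  using assms o_plus_iff[of x] o_plus_iff[of "inv x"] v_type_iff by auto

lemma inv_conj: "x \<in> carrier G \<Longrightarrow> z \<in> carrier G \<Longrightarrow> inv (z \<otimes> x \<otimes> inv z) = z \<otimes> inv x \<otimes> inv z"
  by (simp add: inv_mult_group m_assoc)

lemma v_type_conj:
  assumes "x \<in> carrier G" "z \<in> carrier G"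
  shows "v_type G le (z \<otimes> x \<otimes> inv z) \<longleftrightarrow> v_type G le x"
  using assms by (simp add: v_type_iff inv_conj conj_le_iff)

lemma o_plus_conj:
  assumes "x \<in> carrier G" "z \<in> carrier G"
  shows "o_plus_type G le (z \<otimes> x \<otimes> inv z) \<longleftrightarrow> o_plus_type G le x"
  using assms by (simp add: o_plus_iff inv_conj conj_le_iff)

text \<open>Since \<open>c \<lesssim> t \<lesssim> inv t\<close>, the product
  \<open>t \<otimes> c\<close> is at most \<open>t\<close>, hence at most \<open>c\<close>. Read
  from the right factor, this says \<open>t \<lesssim> inv c\<close>, so
  \<open>c \<lesssim> inv c\<close>.\<close>

lemma v_type_not_equiv_o_plus:
  assumes "v_type G le t" "o_plus_type G le c" "t \<in> carrier G" "c \<in> carrier G" "t \<lesssim> c" "c \<lesssim> t"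
  shows False
proof -
  have t: "t \<lesssim> inv t" using assms by (simp add: v_type_iff)
  have "c \<lesssim> inv t" using le_trans[OF \<open>c \<lesssim> t\<close> t] assms by simp
  then have "t \<otimes> c \<lesssim> t" using assms mult_le_left_iff by simp
  then have "t \<otimes> c \<lesssim> c" using le_trans \<open>t \<lesssim> c\<close> assms m_closed by blast
  then have "t \<lesssim> inv c" using assms mult_le_right_iff by simp
  then have "c \<lesssim> inv c" using le_trans \<open>c \<lesssim> t\<close> assms inv_closed by blast
  then show False using assms o_plus_iff by simp
qed

text \<open>The element \<open>t \<otimes> x\<close> is strictly above \<open>x\<close>, and
  translating by \<open>t\<close> puts \<open>t \<otimes> (t \<otimes> x)\<close> strictly above
  \<open>t \<otimes> x\<close>. But \<open>inv x\<close> is too small to change the class of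
  \<open>inv t\<close>, so \<open>t \<lesssim> inv (t \<otimes> x)\<close>, which gives the opposite
  inequality.\<close>

lemma v_type_not_separates_inverse:
  assumes v: "v_type G le t" and c: "t \<in> carrier G" "x \<in> carrier G"
    and l: "\<not> t \<lesssim> inv x" and u: "\<not> x \<lesssim> t"
  shows False
proof -
  have t: "t \<lesssim> inv t" "inv t \<lesssim> t" using v by (simp_all add: v_type_iff)
  have tx: "\<not> t \<otimes> x \<lesssim> x" using c l mult_le_right_iff by simp
  have "inv t \<lesssim> x" using t u c le_total[of x t] le_trans[of "inv t" t x] by auto
  then have 1: "\<not> t \<otimes> (t \<otimes> x) \<lesssim> t \<otimes> x" by (rule mult_strict_mono_left) (use tx c in auto)
  have "inv t \<lesssim> inv x \<otimes> inv t" using mult_equiv_right(2)[of "inv x" "inv t"] l c by simp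
  then have "t \<lesssim> inv (t \<otimes> x)"
    using t le_trans[of t "inv t" "inv x \<otimes> inv t"] c by (simp add: inv_mult_group)
  then show False using 1 mult_le_right_iff[of "t \<otimes> x" t] c by simp
qed

text \<open>Otherwise \<open>inv x\<close> is \<open>o^+\<close>-type, hence not equivalent to
  \<open>t\<close>, hence strictly above it, and \<open>t\<close> would separate
  \<open>inv x\<close> from \<open>x\<close>.\<close>

lemma inv_strictly_below:
  assumes "v_type G le t" "t \<in> carrier G" "x \<in> carrier G" "\<not> t \<lesssim> x"
  shows "\<not> t \<lesssim> inv x"
proof
  assume a: "t \<lesssim> inv x"
  have xt: "x \<lesssim> t" using assms le_total by blast
  have "\<not> inv x \<lesssim> x" using le_trans[OF a, of x] assms by auto
  then have o: "o_plus_type G le (inv x)" using assms o_plus_iff[of "inv x"] by simp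
  then have "\<not> inv x \<lesssim> t" using a assms v_type_not_equiv_o_plus[of t "inv x"] by auto
  then show False using v_type_not_separates_inverse[of t "inv x"] assms by simp
qed

text \<open>If \<open>y\<close> is strictly below \<open>inv x\<close>, then
  \<open>x \<otimes> y \<lesssim> x\<close>. Otherwise \<open>inv x \<lesssim> y\<close>, which is
  what is needed to translate the strict inequality between \<open>y\<close> and \<open>t\<close> by
  \<open>x\<close>; the upper end \<open>x \<otimes> t\<close> is at most \<open>t\<close>.\<close>

lemma mult_strictly_below:
  assumes v: "v_type G le t" and c: "t \<in> carrier G" "x \<in> carrier G" "y \<in> carrier G"
    and x: "\<not> t \<lesssim> x" and y: "\<not> t \<lesssim> y"
  shows "\<not> t \<lesssim> x \<otimes> y"
proof (cases "inv x \<lesssim> y")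
  case False
  then show ?thesis using mult_equiv_left(1)[of y x] c x le_trans[of t "x \<otimes> y" x] by auto
next
  case True
  then have 1: "\<not> x \<otimes> t \<lesssim> x \<otimes> y" using mult_strict_mono_left[of x y t] y c by simp
  have t: "t \<lesssim> inv t" "inv t \<lesssim> t" using v by (simp_all add: v_type_iff)
  then have "\<not> inv t \<lesssim> x" using x le_trans[of t "inv t" x] c by auto
  then have "x \<otimes> t \<lesssim> t" using mult_equiv_right(1) c by simp
  then show ?thesis using 1 le_trans[of "x \<otimes> t" t "x \<otimes> y"] c by auto
qed

end

section \<open>Equivalence of the order axioms with the definition by C-relations\<close>

lemma C_qo_group_iff: "C_qo_group G qle \<longleftrightarrow> C_quasi_ordered_group G qle"
proof
  assume "C_quasi_ordered_group G qle"
  then interpret group G by (simp add: C_quasi_ordered_group_def)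
  obtain C where C: "C_relation_on (carrier G) C" "compatible_C G C"
    and qle: "\<And>x y. x \<in> carrier G \<Longrightarrow> y \<in> carrier G \<Longrightarrow> qle x y \<longleftrightarrow> \<not> C x y \<one>\<^bsub>G\<^esub>"
    and qo: "quasi_order_on (carrier G) qle"
    using \<open>C_quasi_ordered_group G qle\<close>
    unfolding C_quasi_ordered_group_def C_quasi_order_def by auto
  have swap: "C x z y" if "C x y z" "x \<in> carrier G" "y \<in> carrier G" "z \<in> carrier G" for x y z
    using C(1) that unfolding C_relation_on_def by blast
  have asym: "\<not> C y x z" if "C x y z" "x \<in> carrier G" "y \<in> carrier G" "z \<in> carrier G" for x y z
    using C(1) that unfolding C_relation_on_def by blast
  have ne: "C x y y" if "x \<noteq> y" "x \<in> carrier G" "y \<in> carrier G" for x y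
    using C(1) that unfolding C_relation_on_def by blast
  have mul: "C (v \<otimes>\<^bsub>G\<^esub> x \<otimes>\<^bsub>G\<^esub> u) (v \<otimes>\<^bsub>G\<^esub> y \<otimes>\<^bsub>G\<^esub> u) (v \<otimes>\<^bsub>G\<^esub> z \<otimes>\<^bsub>G\<^esub> u)"
    if "C x y z" "x \<in> carrier G" "y \<in> carrier G" "z \<in> carrier G" "u \<in> carrier G" "v \<in> carrier G"
    for x y z u v using C(2) that unfolding compatible_C_def by blast
  have conj_C: "C (z \<otimes>\<^bsub>G\<^esub> x \<otimes>\<^bsub>G\<^esub> inv\<^bsub>G\<^esub> z) (z \<otimes>\<^bsub>G\<^esub> y \<otimes>\<^bsub>G\<^esub> inv\<^bsub>G\<^esub> z) \<one>\<^bsub>G\<^esub>"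
    if "C x y \<one>\<^bsub>G\<^esub>" "x \<in> carrier G" "y \<in> carrier G" "z \<in> carrier G" for x y z
    using mul[of x y "\<one>\<^bsub>G\<^esub>" "inv\<^bsub>G\<^esub> z" z] that by simp
  show "C_qo_group G qle"
  proof (unfold_locales, goal_cases)
    case (1 x y)
    then show ?case using qo unfolding quasi_order_on_def totalp_on_def reflp_on_def by metis
  next
    case (2 x y z)
    then show ?case using qo unfolding quasi_order_on_def transp_on_def by blast
  next
    case (3 x)
    then show ?case using qle[of x "\<one>\<^bsub>G\<^esub>"] ne[of x "\<one>\<^bsub>G\<^esub>"] asym[of "\<one>\<^bsub>G\<^esub>" "\<one>\<^bsub>G\<^esub>" "\<one>\<^bsub>G\<^esub>"] by auto
  next
    case (4 x y)
    \<comment> \<open>Left translation by \<open>inv x\<close> takes the triple with entries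
      \<open>x \<otimes> y\<close>, \<open>x\<close>, \<open>1\<close> to the one with entries
      \<open>y\<close>, \<open>1\<close>, \<open>inv x\<close>; the last two are then
      swapped.\<close>
    have "C (x \<otimes>\<^bsub>G\<^esub> y) x \<one>\<^bsub>G\<^esub> \<longleftrightarrow> C y (inv\<^bsub>G\<^esub> x) \<one>\<^bsub>G\<^esub>"
    proof
      assume "C (x \<otimes>\<^bsub>G\<^esub> y) x \<one>\<^bsub>G\<^esub>"
      from mul[OF this, of "\<one>\<^bsub>G\<^esub>" "inv\<^bsub>G\<^esub> x"] show "C y (inv\<^bsub>G\<^esub> x) \<one>\<^bsub>G\<^esub>"
        using 4 by (simp add: m_assoc[symmetric] swap)
    next
      assume "C y (inv\<^bsub>G\<^esub> x) \<one>\<^bsub>G\<^esub>"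
      from mul[OF this, of "\<one>\<^bsub>G\<^esub>" x] show "C (x \<otimes>\<^bsub>G\<^esub> y) x \<one>\<^bsub>G\<^esub>"
        using 4 by (simp add: swap)
    qed
    then show ?case using qle 4 by simp
  next
    case (5 x y z)
    \<comment> \<open>Compatibility transports \<open>C\<close>, not its negation, so a violation is
      conjugated back by \<open>inv z\<close>.\<close>
    have "\<not> C (z \<otimes>\<^bsub>G\<^esub> x \<otimes>\<^bsub>G\<^esub> inv\<^bsub>G\<^esub> z) (z \<otimes>\<^bsub>G\<^esub> y \<otimes>\<^bsub>G\<^esub> inv\<^bsub>G\<^esub> z) \<one>\<^bsub>G\<^esub>"
    proof
      have eq: "inv\<^bsub>G\<^esub> z \<otimes>\<^bsub>G\<^esub> (z \<otimes>\<^bsub>G\<^esub> w \<otimes>\<^bsub>G\<^esub> inv\<^bsub>G\<^esub> z) \<otimes>\<^bsub>G\<^esub> z = w" if "w \<in> carrier G" for w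
        using 5 that by (simp add: m_assoc) (simp add: m_assoc[symmetric])
      assume "C (z \<otimes>\<^bsub>G\<^esub> x \<otimes>\<^bsub>G\<^esub> inv\<^bsub>G\<^esub> z) (z \<otimes>\<^bsub>G\<^esub> y \<otimes>\<^bsub>G\<^esub> inv\<^bsub>G\<^esub> z) \<one>\<^bsub>G\<^esub>"
      from conj_C[OF this, of "inv\<^bsub>G\<^esub> z"] have "C x y \<one>\<^bsub>G\<^esub>" using 5 eq by simp
      then show False using 5 qle by simp
    qed
    then show ?case using qle 5 by simp
  qed
next
  assume "C_qo_group G qle"
  then interpret C_qo_group G qle .
  define C where "C x y z = (\<not> qle (x \<otimes>\<^bsub>G\<^esub> inv\<^bsub>G\<^esub> z) (y \<otimes>\<^bsub>G\<^esub> inv\<^bsub>G\<^esub> z))" for x y z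
  have "quasi_order_on (carrier G) qle"
    unfolding quasi_order_on_def
    by (auto simp: reflp_on_def transp_on_def totalp_on_def le_refl intro: le_trans dest: le_total)
  moreover have "C_relation_on (carrier G) C"
    unfolding C_relation_on_def
  proof (intro conjI ballI impI)
    fix x y z assume c: "x \<in> carrier G" "y \<in> carrier G" "z \<in> carrier G"
    \<comment> \<open>Multiplying by \<open>z \<otimes> inv y\<close> moves the base point from
      \<open>z\<close> to \<open>y\<close>, so \<open>mult_le_right_iff\<close> becomes the symmetry
      of \<open>C\<close> in its last two arguments.\<close>
    have "(x \<otimes>\<^bsub>G\<^esub> inv\<^bsub>G\<^esub> z) \<otimes>\<^bsub>G\<^esub> (z \<otimes>\<^bsub>G\<^esub> inv\<^bsub>G\<^esub> y) = x \<otimes>\<^bsub>G\<^esub> inv\<^bsub>G\<^esub> y"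
      using c by (simp add: m_assoc) (simp add: m_assoc[symmetric])
    then have "qle (x \<otimes>\<^bsub>G\<^esub> inv\<^bsub>G\<^esub> y) (z \<otimes>\<^bsub>G\<^esub> inv\<^bsub>G\<^esub> y) \<longleftrightarrow> qle (x \<otimes>\<^bsub>G\<^esub> inv\<^bsub>G\<^esub> z) (y \<otimes>\<^bsub>G\<^esub> inv\<^bsub>G\<^esub> z)"
      using mult_le_right_iff[of "z \<otimes>\<^bsub>G\<^esub> inv\<^bsub>G\<^esub> y" "x \<otimes>\<^bsub>G\<^esub> inv\<^bsub>G\<^esub> z"] c by (simp add: inv_mult_group)
    then show "C x z y" if "C x y z" using that by (simp add: C_def)
    show "\<not> C y x z" if "C x y z"
      using that c le_total[of "x \<otimes>\<^bsub>G\<^esub> inv\<^bsub>G\<^esub> z" "y \<otimes>\<^bsub>G\<^esub> inv\<^bsub>G\<^esub> z"] by (auto simp: C_def)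
    show "C w y z \<or> C x w z" if "C x y z" "w \<in> carrier G" for w
      using that c le_trans[of "x \<otimes>\<^bsub>G\<^esub> inv\<^bsub>G\<^esub> z" "w \<otimes>\<^bsub>G\<^esub> inv\<^bsub>G\<^esub> z" "y \<otimes>\<^bsub>G\<^esub> inv\<^bsub>G\<^esub> z"]
      by (auto simp: C_def)
  next
    fix x y assume c: "x \<in> carrier G" "y \<in> carrier G" "x \<noteq> y"
    then show "C x y y" using le_one_iff[of "x \<otimes>\<^bsub>G\<^esub> inv\<^bsub>G\<^esub> y"] inv_equality[of x "inv\<^bsub>G\<^esub> y"]
      by (auto simp: C_def)
  qed
  moreover have "compatible_C G C"
    unfolding compatible_C_def
  proof (intro ballI impI)
    fix x y z u v
    assume c: "x \<in> carrier G" "y \<in> carrier G" "z \<in> carrier G" "u \<in> carrier G" "v \<in> carrier G"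
      and C: "C x y z"
    \<comment> \<open>The right factor \<open>u\<close> cancels, and \<open>v\<close> acts by
      conjugation only.\<close>
    have "v \<otimes>\<^bsub>G\<^esub> w \<otimes>\<^bsub>G\<^esub> u \<otimes>\<^bsub>G\<^esub> inv\<^bsub>G\<^esub> (v \<otimes>\<^bsub>G\<^esub> z \<otimes>\<^bsub>G\<^esub> u) = v \<otimes>\<^bsub>G\<^esub> (w \<otimes>\<^bsub>G\<^esub> inv\<^bsub>G\<^esub> z) \<otimes>\<^bsub>G\<^esub> inv\<^bsub>G\<^esub> v"
      if "w \<in> carrier G" for w
    proof -
      have "u \<otimes>\<^bsub>G\<^esub> (inv\<^bsub>G\<^esub> u \<otimes>\<^bsub>G\<^esub> p) = p" if "p \<in> carrier G" for p
        using that c by (simp add: m_assoc[symmetric])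
      then show ?thesis using c that by (simp add: m_assoc inv_mult_group)
    qed
    then show "C (v \<otimes>\<^bsub>G\<^esub> x \<otimes>\<^bsub>G\<^esub> u) (v \<otimes>\<^bsub>G\<^esub> y \<otimes>\<^bsub>G\<^esub> u) (v \<otimes>\<^bsub>G\<^esub> z \<otimes>\<^bsub>G\<^esub> u)"
      using C c by (simp add: C_def conj_le_iff)
  qed
  ultimately have "C_quasi_order G qle" unfolding C_quasi_order_def by (auto simp: C_def)
  then show "C_quasi_ordered_group G qle" by (simp add: C_quasi_ordered_group_def is_group)
qed

section \<open>Subgroups and quotients\<close>

context C_qo_group
begin

text \<open>The order axioms are universal, so they restrict to a subgroup once the inverses are
  known to agree.\<close>

lemma C_qo_subgroup:
  assumes "subgroup H G"
  shows "C_qo_group (G\<lparr>carrier := H\<rparr>) le"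
proof -
  interpret H: subgroup H G by fact
  interpret H': group "G\<lparr>carrier := H\<rparr>" by (rule subgroup_imp_group) fact
  show ?thesis
    by unfold_locales
      (use H.mem_carrier le_total le_trans le_one_iff mult_le_left_iff conj_mono
        m_inv_consistent[OF assms] in auto)
qed

text \<open>\<open>Mod\<close> is built from right cosets and \<open>quotient_le\<close> from left
  ones; normality identifies them.\<close>

lemma quotient_le_rcoset:
  assumes "N \<lhd> G" "convex_in (carrier G) le N" "a \<in> carrier G" "b \<in> carrier G"
  shows "quotient_le G le N (N #> a) (N #> b) \<longleftrightarrow> a \<in> N \<or> (b \<notin> N \<and> a \<lesssim> b)"
  using quotient_le_coset[of G le N a b] assms normal.coset_eq[OF assms(1)]
    normal_imp_subgroup[OF assms(1)] C_qo_group_iff[of G le] C_qo_group_axioms by simp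

lemma C_qo_quotient:
  assumes N: "N \<lhd> G" and conv: "convex_in (carrier G) le N"
  shows "C_qo_group (G Mod N) (quotient_le G le N)"
proof -
  interpret N: normal N G by (rule N)
  interpret Q: group "G Mod N" by (rule N.factorgroup_is_group)
  have rep: "\<exists>a\<in>carrier G. A = N #> a" if "A \<in> carrier (G Mod N)" for A
    using that by (auto simp: FactGroup_def RCOSETS_def)
  note q = quotient_le_rcoset[OF N conv]
  have eq_one: "N #> a = N \<longleftrightarrow> a \<in> N" if "a \<in> carrier G" for a
    using that rcos_self[OF that N.subgroup_axioms] coset_join2[OF that N.subgroup_axioms] by auto
  have one: "\<one>\<^bsub>G Mod N\<^esub> = N #> \<one>" by (simp add: N.subset coset_mult_one)
  have mult: "(N #> a) \<otimes>\<^bsub>G Mod N\<^esub> (N #> b) = N #> (a \<otimes> b)"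
    if "a \<in> carrier G" "b \<in> carrier G" for a b
    using that N.rcos_sum by simp
  have invN: "inv\<^bsub>G Mod N\<^esub> (N #> a) = N #> inv a" if "a \<in> carrier G" for a
    using that N.inv_FactGroup N.rcos_inv by (auto simp: FactGroup_def RCOSETS_def)
  \<comment> \<open>A convex subgroup contains the least element \<open>1\<close>, so it is an
    initial segment.\<close>
  have below: "a \<in> N" if "a \<lesssim> b" "b \<in> N" "a \<in> carrier G" for a b
    using conv that one_le N.one_closed unfolding convex_in_def by blast
  have in_conj: "z \<otimes> a \<otimes> inv z \<in> N \<longleftrightarrow> a \<in> N" if "z \<in> carrier G" "a \<in> carrier G" for a z
  proof
    assume "z \<otimes> a \<otimes> inv z \<in> N"
    then have "inv z \<otimes> (z \<otimes> a \<otimes> inv z) \<otimes> inv (inv z) \<in> N"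
      using that N.inv_op_closed2 inv_closed by blast
    then show "a \<in> N" using that by (simp add: m_assoc) (simp add: m_assoc[symmetric])
  qed (use that N.inv_op_closed2 in blast)
  show ?thesis
  proof (unfold_locales, goal_cases)
    case (1 A B)
    then show ?case using q le_total rep by metis
  next
    case (2 A B D)
    then obtain a b d where "a \<in> carrier G" "b \<in> carrier G" "d \<in> carrier G"
      "A = N #> a" "B = N #> b" "D = N #> d" using rep by metis
    then show ?case using 2 q le_trans[of a b d] by auto
  next
    case (3 A)
    then obtain a where "a \<in> carrier G" "A = N #> a" using rep by metis
    then show ?case unfolding one using q[of a \<one>] N.one_closed eq_one
      by (simp add: N.subset coset_mult_one)
  next
    case (4 A B)
    then obtain a b where c: "a \<in> carrier G" "b \<in> carrier G" "A = N #> a" "B = N #> b"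
      using rep by metis
    \<comment> \<open>The facts \<open>ab\<close>, \<open>ab'\<close> and \<open>inv\<close> settle
      the cases in which a representative lies in \<open>N\<close>; outside \<open>N\<close> the
      claim is \<open>mult_le_left_iff\<close> in the group itself.\<close>
    have ab: "a \<in> N \<Longrightarrow> a \<otimes> b \<in> N \<longleftrightarrow> b \<in> N"
    proof
      have "inv a \<otimes> (a \<otimes> b) = b" using c by (simp add: m_assoc[symmetric])
      then show "b \<in> N" if "a \<in> N" "a \<otimes> b \<in> N"
        using N.m_closed[OF N.m_inv_closed[OF that(1)] that(2)] by simp
    qed (rule N.m_closed)
    have ab': "b \<lesssim> inv a" if "b \<in> N" "a \<notin> N"
    proof -
      have "inv a \<notin> N" using that c N.m_inv_closed[of "inv a"] by auto
      then show ?thesis using below[of "inv a" b] that c le_total[of "inv a" b] by auto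
    qed
    have inv: "inv a \<in> N \<longleftrightarrow> a \<in> N" using c N.m_inv_closed[of "inv a"] by auto
    have "a \<otimes> b \<in> N \<Longrightarrow> a \<notin> N \<Longrightarrow> a \<otimes> b \<lesssim> a"
      using below[of a "a \<otimes> b"] c le_total[of a "a \<otimes> b"] by auto
    then show ?case unfolding c(3,4)
      using c(1,2) ab ab' inv mult_le_left_iff by (auto simp: mult invN q simp del: mult_FactGroup)
  next
    case (5 A B Z)
    then obtain a b z where "a \<in> carrier G" "b \<in> carrier G" "z \<in> carrier G"
      "A = N #> a" "B = N #> b" "Z = N #> z" using rep by metis
    then show ?case using 5(1) conj_mono in_conj by (auto simp: mult invN q simp del: mult_FactGroup)
  qed
qed

section \<open>Valuational means that all elements are v-type\<close>

text \<open>The values of the valuation are the initial segments generated by the elements \<open>\<noteq> \<one>\<close>,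
  larger segments being smaller values.\<close>

lemma valuational_if_all_v_type:
  assumes v: "\<And>x. x \<in> carrier G \<Longrightarrow> v_type G le x"
  shows "valuational G le"
proof (rule valuationalI)
  show "C_quasi_ordered_group G le" using C_qo_group_iff C_qo_group_axioms by blast
  define D where "D x = {y \<in> carrier G. y \<lesssim> x}" for x
  define \<Gamma> where "\<Gamma> = D ` (carrier G - {\<one>})"
  define r where "r = {(A, B). A \<in> \<Gamma> \<and> B \<in> \<Gamma> \<and> B \<subseteq> A}"
  define val where "val x = (if x = \<one> then None else Some (D x))" for x
  have D: "D x \<subseteq> D y \<longleftrightarrow> x \<lesssim> y" if "x \<in> carrier G" "y \<in> carrier G" for x y
    using that le_refl le_trans unfolding D_def by blast
  have le: "val_le r (val x) (val y) \<longleftrightarrow> y \<lesssim> x" if "x \<in> carrier G" "y \<in> carrier G" for x y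
    using that D[of y x] le_one_iff one_le by (auto simp: val_le_def val_def r_def \<Gamma>_def)
  show "induced_by_valuation G r val le" by (simp add: induced_by_valuation_def le)
  have "linear_order_on \<Gamma> r"
    unfolding linear_order_on_def partial_order_on_def preorder_on_def
  proof (intro conjI)
    show "total_on \<Gamma> r"
    proof (rule total_onI)
      fix A B assume "A \<in> \<Gamma>" "B \<in> \<Gamma>"
      then obtain x y where "x \<in> carrier G" "y \<in> carrier G" "A = D x" "B = D y"
        unfolding \<Gamma>_def by auto
      then have "A \<subseteq> B \<or> B \<subseteq> A" using D le_total[of x y] by simp
      then show "(A, B) \<in> r \<or> (B, A) \<in> r" using \<open>A \<in> \<Gamma>\<close> \<open>B \<in> \<Gamma>\<close> by (auto simp: r_def)
    qed
  qed (auto simp: r_def refl_on_def intro!: transI antisymI)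
  \<comment> \<open>The minimum of the values belongs to the larger of \<open>x\<close> and
    \<open>y\<close>. As that element is equivalent to its inverse, it bounds
    \<open>x \<otimes> inv y\<close>.\<close>
  moreover have "val_le r (val_min r (val x) (val y)) (val (x \<otimes> inv y))"
    if c: "x \<in> carrier G" "y \<in> carrier G" for x y
  proof (cases "y \<lesssim> x")
    case True
    then have "inv y \<lesssim> x" "x \<lesssim> inv x"
      using v[of x] v[of y] c le_trans[of "inv y" y x] by (auto simp: v_type_iff)
    then have "x \<otimes> inv y \<lesssim> x" using c mult_le_left_iff le_trans[of "inv y" x "inv x"] by simp
    then show ?thesis using True c by (simp add: val_min_def le)
  next
    case False
    then have "x \<lesssim> y" using c le_total by blast
    then have "x \<otimes> inv y \<lesssim> inv y" using c mult_le_right_iff by simp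
    then have "x \<otimes> inv y \<lesssim> y" using v[of y] c le_trans[of "x \<otimes> inv y" "inv y" y]
      by (simp add: v_type_iff)
    then show ?thesis using False c by (simp add: val_min_def le)
  qed
  ultimately show "valuation G \<Gamma> r val"
    unfolding valuation_def by (auto simp: val_def[of _] \<Gamma>_def conj_by_def conj_le_iff le[unfolded val_def])
qed

end

text \<open>Writing \<open>inv y\<close> as \<open>1\<close> times \<open>inv y\<close> gives
  \<open>v(inv y) \<ge> min(\<infinity>, v(y)) = v(y)\<close>; this is applied to \<open>x\<close>
  and to \<open>inv x\<close>.\<close>

lemma valuational_imp_v_type:
  assumes "valuational G qle" "x \<in> carrier G"
  shows "v_type G qle x"
proof -
  interpret C_qo_group G qle using assms by (simp add: C_qo_group_iff valuational_def)
  obtain \<Gamma> :: "'a set" and r v where v: "valuation G \<Gamma> r v" "induced_by_valuation G r v qle"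
    using assms unfolding valuational_def by blast
  have "qle (inv\<^bsub>G\<^esub> y) y" if y: "y \<in> carrier G" for y
  proof -
    have "val_min r (v \<one>\<^bsub>G\<^esub>) (v y) = v y"
    proof -
      have "v \<one>\<^bsub>G\<^esub> = None" using v(1) unfolding valuation_def by simp
      then show ?thesis by (auto simp: val_min_def val_le_def)
    qed
    moreover have "val_le r (val_min r (v \<one>\<^bsub>G\<^esub>) (v y)) (v (\<one>\<^bsub>G\<^esub> \<otimes>\<^bsub>G\<^esub> inv\<^bsub>G\<^esub> y))"
      using v(1) y one_closed unfolding valuation_def by blast
    ultimately show ?thesis using v(2) y unfolding induced_by_valuation_def by simp
  qed
  from this[of x] this[of "inv\<^bsub>G\<^esub> x"] show ?thesis using assms by (simp add: v_type_iff)
qed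

section \<open>The set \<open>T\<close> and the subgroups \<open>L\<close> and \<open>U\<close> of a
  v-type element\<close>

context C_qo_group
begin

context
  fixes g
  assumes g: "g \<in> carrier G" "g \<noteq> \<one>" "v_type G le g"
begin

abbreviation "T \<equiv> T_set G le g"
abbreviation "L \<equiv> lower_group G le g"
abbreviation "U \<equiv> upper_group G le g"

lemma T_carrier: "t \<in> T \<Longrightarrow> t \<in> carrier G" and T_v_type: "t \<in> T \<Longrightarrow> v_type G le t"
  by (simp_all add: T_set_def)

lemma L_iff: "x \<in> L \<longleftrightarrow> x \<in> carrier G \<and> (\<forall>t\<in>T. \<not> t \<lesssim> x)"
  using T_carrier qo_less_iff by (auto simp: lower_group_def)

lemma g_in_T: "g \<in> T"
  using g v_type_not_equiv_o_plus by (auto simp: T_set_def between_def)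

lemma L_T_disjoint: "x \<in> L \<Longrightarrow> x \<notin> T"
  using L_iff le_refl by blast

text \<open>Membership in \<open>T\<close> only compares with \<open>g\<close>, but \<open>c\<close>
  lies on one side of \<open>g\<close>, hence between \<open>g\<close> and one of \<open>s\<close>,
  \<open>t\<close>.\<close>

lemma T_no_o_plus_between:
  assumes "s \<in> T" "t \<in> T" "s \<lesssim> c" "c \<lesssim> t" "c \<in> carrier G"
  shows "\<not> o_plus_type G le c"
  using assms le_total[of c g] g by (auto simp: T_set_def between_def)

text \<open>As \<open>s\<close> is not in \<open>T\<close>, some \<open>o^+\<close>-type
  \<open>c\<close> lies between \<open>s\<close> and \<open>g\<close>, and necessarily
  \<open>s \<lesssim> c \<lesssim> g\<close>. An element of \<open>T\<close> below \<open>c\<close>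
  would make \<open>c\<close> an \<open>o^+\<close>-type element between two members of
  \<open>T\<close>, so \<open>c\<close> is in \<open>L\<close>.\<close>

lemma v_type_in_L_below_o_plus:
  assumes "s \<in> L" "v_type G le s" "s \<noteq> \<one>"
  obtains c where "c \<in> L" "o_plus_type G le c" "s \<lesssim> c"
proof -
  have s: "s \<in> carrier G" "\<not> g \<lesssim> s" using assms L_iff g_in_T by auto
  obtain c where c: "c \<in> carrier G" "o_plus_type G le c" "between le c s g"
    using assms L_T_disjoint s by (auto simp: T_set_def)
  then have scg: "s \<lesssim> c" "c \<lesssim> g"
    using s g le_trans[of g c s] by (auto simp: between_def)
  then have "c \<in> L" using c T_no_o_plus_between[OF _ g_in_T] L_iff by blast
  then show thesis using that c scg by blast
qed

lemma T_inv: "t \<in> T \<Longrightarrow> inv t \<in> T"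
proof -
  assume t: "t \<in> T"
  then have tc: "t \<in> carrier G" "t \<noteq> \<one>" "t \<lesssim> inv t" "inv t \<lesssim> t"
    by (auto simp: T_set_def v_type_iff)
  have "between le c t g" if "between le c (inv t) g" "c \<in> carrier G" for c
    using that tc g le_trans[of t "inv t" c] le_trans[of c "inv t" t] by (auto simp: between_def)
  then show ?thesis using t tc by (auto simp: T_set_def v_type_iff inv_eq_1_iff)
qed

text \<open>An \<open>o^+\<close>-type element between \<open>x\<close> and \<open>g\<close> would
  also lie between \<open>s\<close> and \<open>g\<close> or between \<open>g\<close> and
  \<open>t\<close>.\<close>

lemma T_convex:
  assumes "s \<in> T" "t \<in> T" "s \<lesssim> x" "x \<lesssim> t" "x \<in> carrier G" "v_type G le x"
  shows "x \<in> T"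
proof -
  have s: "s \<in> carrier G" "s \<noteq> \<one>" and t: "t \<in> carrier G" using assms by (auto simp: T_set_def)
  then have "x \<noteq> \<one>" using assms le_one_iff by auto
  moreover have "\<not> between le c x g" if "c \<in> carrier G" "o_plus_type G le c" for c
    using that assms s t g T_no_o_plus_between[OF assms(1) g_in_T, of c]
      T_no_o_plus_between[OF g_in_T assms(2), of c] le_trans[of s x c] le_trans[of c x t]
    by (auto simp: between_def)
  ultimately show ?thesis using assms by (auto simp: T_set_def)
qed

lemma subgroup_L: "subgroup L G"
proof
  show "\<one> \<in> L" using L_iff le_one_iff by (auto simp: T_set_def)
  show "x \<otimes> y \<in> L" if "x \<in> L" "y \<in> L" for x y
    using that L_iff T_carrier T_v_type mult_strictly_below by auto
  show "inv x \<in> L" if "x \<in> L" for x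
    using that L_iff T_carrier T_v_type inv_strictly_below by auto
qed (use L_iff in auto)

text \<open>Elements of \<open>L\<close> are too small to change the class of \<open>t\<close> or of
  \<open>inv t\<close>. So the product and its inverse are both equivalent to \<open>t\<close>, and
  \<open>T_convex\<close> applies.\<close>

lemma T_mult_L:
  assumes "t \<in> T" "x \<in> L"
  shows "t \<otimes> x \<in> T" "x \<otimes> t \<in> T"
proof -
  have t: "t \<in> carrier G" "t \<lesssim> inv t" "inv t \<lesssim> t" using assms by (auto simp: T_set_def v_type_iff)
  have inv_x: "inv x \<in> L" using assms subgroup.m_inv_closed[OF subgroup_L] by simp
  have eq: "s \<otimes> y \<lesssim> s" "s \<lesssim> s \<otimes> y" "y \<otimes> s \<lesssim> s" "s \<lesssim> y \<otimes> s"
    if "s \<in> T" "y \<in> L" for s y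
    using that T_inv[of s] L_iff T_carrier mult_equiv_left[of y s] mult_equiv_right[of y s] by auto
  have x: "x \<in> carrier G" "inv x \<in> carrier G" using assms inv_x L_iff by auto
  have e1: "t \<otimes> x \<lesssim> t" "t \<lesssim> t \<otimes> x" "x \<otimes> t \<lesssim> t" "t \<lesssim> x \<otimes> t" using eq assms by auto
  have e2: "inv t \<otimes> inv x \<lesssim> inv t" "inv t \<lesssim> inv t \<otimes> inv x"
    "inv x \<otimes> inv t \<lesssim> inv t" "inv t \<lesssim> inv x \<otimes> inv t" using eq T_inv[OF assms(1)] inv_x by auto
  have "t \<otimes> x \<lesssim> inv x \<otimes> inv t" "inv x \<otimes> inv t \<lesssim> t \<otimes> x"
    "x \<otimes> t \<lesssim> inv t \<otimes> inv x" "inv t \<otimes> inv x \<lesssim> x \<otimes> t"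
    using le_trans[OF le_trans[OF e1(1) t(2)] e2(4)] le_trans[OF le_trans[OF e2(3) t(3)] e1(2)]
      le_trans[OF le_trans[OF e1(3) t(2)] e2(2)] le_trans[OF le_trans[OF e2(1) t(3)] e1(4)] t(1) x
    by simp_all
  then have "v_type G le (t \<otimes> x)" "v_type G le (x \<otimes> t)"
    using t(1) x by (simp_all add: v_type_iff inv_mult_group)
  then show "t \<otimes> x \<in> T" "x \<otimes> t \<in> T"
    using T_convex[OF assms(1) assms(1)] e1 t x by auto
qed

text \<open>A product outside \<open>L\<close> has a member of \<open>T\<close> below it and one
  above it, so it is not \<open>o^+\<close>-type. If its inverse were, the product would lie below
  the inverse, which would then be caught between members of \<open>T\<close> as well. Hence the
  product is v-type.\<close>

lemma T_mult_T:
  assumes "a \<in> T" "b \<in> T"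
  shows "a \<otimes> b \<in> U"
proof (cases "a \<otimes> b \<in> L")
  case False
  have c: "a \<in> carrier G" "b \<in> carrier G" using assms T_carrier by auto
  \<comment> \<open>The larger of the two v-type factors serves as \<open>m\<close>.\<close>
  have bound: "\<exists>m\<in>T. x \<otimes> y \<lesssim> m" if "x \<in> T" "y \<in> T" for x y
  proof -
    have xy: "x \<in> carrier G" "y \<in> carrier G" "x \<lesssim> inv x" "y \<lesssim> inv y"
      using that by (auto simp: T_set_def v_type_iff)
    have "x \<otimes> y \<lesssim> y" if "x \<lesssim> y" using that mult_le_right_iff xy le_trans[of x y "inv y"] by simp
    moreover have "x \<otimes> y \<lesssim> x" if "y \<lesssim> x" using that mult_le_left_iff xy le_trans[of y x "inv x"] by simp
    ultimately show ?thesis using that le_total xy by blast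
  qed
  obtain t where t: "t \<in> T" "t \<lesssim> a \<otimes> b" using False c L_iff by auto
  have tc: "t \<in> carrier G" using t T_carrier by blast
  obtain m where m: "m \<in> T" "a \<otimes> b \<lesssim> m" using bound assms by blast
  obtain n where n: "n \<in> T" "inv (a \<otimes> b) \<lesssim> n"
    using bound T_inv assms c by (metis inv_mult_group)
  have 1: "\<not> o_plus_type G le (a \<otimes> b)" using T_no_o_plus_between t m c by blast
  have "v_type G le (a \<otimes> b)"
  proof (rule type_cases[of "a \<otimes> b"])
    assume o: "o_plus_type G le (inv (a \<otimes> b))"
    then have "a \<otimes> b \<lesssim> inv (a \<otimes> b)"
      using c o_plus_iff[of "inv (a \<otimes> b)"] le_total[of "a \<otimes> b" "inv (a \<otimes> b)"] by auto
    then have "t \<lesssim> inv (a \<otimes> b)" using t tc c le_trans m_closed inv_closed by blast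
    then show ?thesis using o n t T_no_o_plus_between[of t n] c by auto
  qed (use 1 c in auto)
  then show ?thesis using T_convex[OF t(1) m(1)] t m c by (simp add: upper_group_def)
qed (simp add: upper_group_def)

lemma subgroup_U: "subgroup U G"
proof
  show "\<one> \<in> U" using subgroup.one_closed[OF subgroup_L] by (simp add: upper_group_def)
  show "x \<otimes> y \<in> U" if "x \<in> U" "y \<in> U" for x y
    using that T_mult_T[of x y] T_mult_L subgroup.m_closed[OF subgroup_L] by (auto simp: upper_group_def)
  show "inv x \<in> U" if "x \<in> U" for x
    using that T_inv subgroup.m_inv_closed[OF subgroup_L] by (auto simp: upper_group_def)
qed (use L_iff T_carrier in \<open>auto simp: upper_group_def\<close>)

lemma T_conj:
  assumes "a \<in> T" "t \<in> T"
  shows "a \<otimes> t \<otimes> inv a \<in> T"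
proof (rule ccontr)
  define s where "s = a \<otimes> t \<otimes> inv a"
  have c: "a \<in> carrier G" "t \<in> carrier G" "t \<noteq> \<one>" using assms by (auto simp: T_set_def)
  have undo: "inv a \<otimes> s \<otimes> inv (inv a) = t" "inv a \<otimes> a \<otimes> inv (inv a) = a"
    using c by (simp_all add: s_def m_assoc) (simp_all add: m_assoc[symmetric])
  have sc: "s \<in> carrier G" "v_type G le s" using c T_v_type assms by (simp_all add: s_def v_type_conj)
  have "s \<noteq> \<one>" using undo c by auto
  assume "a \<otimes> t \<otimes> inv a \<notin> T"
  \<comment> \<open>Since \<open>U\<close> is a group, failing to be in \<open>T\<close> means being
    in \<open>L\<close>.\<close>
  moreover have "s \<in> U"
    using assms subgroup.m_closed[OF subgroup_U] subgroup.m_inv_closed[OF subgroup_U]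
    by (simp add: s_def upper_group_def)
  ultimately have "s \<in> L" by (simp add: s_def upper_group_def)
  then obtain d where d: "d \<in> L" "o_plus_type G le d" "s \<lesssim> d"
    using v_type_in_L_below_o_plus sc \<open>s \<noteq> \<one>\<close> by blast
  have dc: "d \<in> carrier G" "d \<lesssim> a" using d L_iff assms le_total[of d a] c by auto
  \<comment> \<open>Conjugation by \<open>inv a\<close> sends \<open>s\<close> back to
    \<open>t\<close> and fixes \<open>a\<close>, so \<open>s \<lesssim> d \<lesssim> a\<close>
    becomes \<open>t \<lesssim> e \<lesssim> a\<close>.\<close>
  define e where "e = inv a \<otimes> d \<otimes> inv (inv a)"
  have e: "e \<in> carrier G" "o_plus_type G le e" using d dc c o_plus_conj[of d "inv a"] by (auto simp: e_def)
  have "t \<lesssim> e" "e \<lesssim> a"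
    using conj_mono[OF d(3), of "inv a"] conj_mono[OF dc(2), of "inv a"] undo c dc sc
    by (simp_all add: e_def)
  then show False using T_no_o_plus_between assms e by blast
qed

text \<open>If conjugation by a member of \<open>T\<close> moved \<open>x\<close> out of
  \<open>L\<close>, the result would be in \<open>T\<close>, and conjugating back with
  \<open>T_conj\<close> would put \<open>x\<close> itself in \<open>T\<close>.\<close>

lemma L_conj:
  assumes "a \<in> U" "x \<in> L"
  shows "a \<otimes> x \<otimes> inv a \<in> L"
proof (cases "a \<in> L")
  case True
  then show ?thesis using assms subgroup_L by (simp add: subgroup.m_closed subgroup.m_inv_closed)
next
  case False
  then have a: "a \<in> T" using assms by (simp add: upper_group_def)
  have c: "a \<in> carrier G" "x \<in> carrier G" using a T_carrier assms L_iff by auto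
  show ?thesis
  proof (rule ccontr)
    assume "a \<otimes> x \<otimes> inv a \<notin> L"
    moreover have "a \<otimes> x \<otimes> inv a \<in> U"
      using assms subgroup.m_closed[OF subgroup_U] subgroup.m_inv_closed[OF subgroup_U]
      by (simp add: upper_group_def)
    ultimately have "a \<otimes> x \<otimes> inv a \<in> T" by (simp add: upper_group_def)
    then have "inv a \<otimes> (a \<otimes> x \<otimes> inv a) \<otimes> inv (inv a) \<in> T" using T_conj T_inv a by blast
    moreover have "inv a \<otimes> (a \<otimes> x \<otimes> inv a) \<otimes> inv (inv a) = x"
      using c by (simp add: m_assoc) (simp add: m_assoc[symmetric])
    ultimately show False using assms L_T_disjoint by simp
  qed
qed

section \<open>\<open>L\<close> has the required properties and is least\<close>

lemma lower_group_normal_convex_valuational: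
  "normal_convex_valuational (G\<lparr>carrier := U\<rparr>) le L"
proof -
  let ?K = "G\<lparr>carrier := U\<rparr>"
  interpret K: C_qo_group ?K le by (rule C_qo_subgroup) (rule subgroup_U)
  have LU: "L \<subseteq> U" by (simp add: upper_group_def)
  have inv_K: "inv\<^bsub>?K\<^esub> x = inv x" if "x \<in> U" for x
    using that m_inv_consistent[OF subgroup_U] by simp
  have sub: "subgroup L ?K" using subgroup_incl[OF subgroup_L subgroup_U LU] .
  have N: "L \<lhd> ?K" using sub L_conj inv_K by (auto simp: K.normal_inv_iff)
  \<comment> \<open>\<open>L\<close> is given by strict upper bounds, so it is closed
    downwards.\<close>
  have conv: "convex_in (carrier ?K) le L"
    unfolding convex_in_def
  proof (intro conjI ballI impI)
    fix s t a assume "s \<in> L" "t \<in> L" "a \<in> carrier ?K" "le s a \<and> le a t"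
    moreover from this have "a \<in> carrier G" using subgroup.subset[OF subgroup_U] by auto
    ultimately show "a \<in> L" using L_iff T_carrier le_trans[of _ a t] by blast
  qed (use LU in simp)
  interpret N: normal L ?K by (rule N)
  interpret Q: C_qo_group "?K Mod L" "quotient_le ?K le L" by (rule K.C_qo_quotient[OF N conv])
  have "valuational (?K Mod L) (quotient_le ?K le L)"
  proof (rule Q.valuational_if_all_v_type)
    fix X assume "X \<in> carrier (?K Mod L)"
    then obtain a where a: "a \<in> carrier ?K" "X = L #>\<^bsub>?K\<^esub> a"
      by (auto simp: FactGroup_def RCOSETS_def)
    then have "inv\<^bsub>?K Mod L\<^esub> X = L #>\<^bsub>?K\<^esub> inv\<^bsub>?K\<^esub> a"
      using N.inv_FactGroup N.rcos_inv \<open>X \<in> carrier _\<close> by simp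
    \<comment> \<open>A representative in \<open>U\<close> outside \<open>L\<close> lies in
      \<open>T\<close>, where it is equivalent to its inverse, again in \<open>T\<close>; on such
      cosets the quotient order is the order of representatives.\<close>
    moreover have "a \<notin> L \<Longrightarrow> le a (inv a) \<and> le (inv a) a \<and> inv a \<notin> L"
      using a(1) T_inv[of a] T_v_type[of a] L_T_disjoint[of "inv a"]
      by (auto simp: upper_group_def v_type_iff)
    moreover have "a \<in> L \<Longrightarrow> inv a \<in> L" using subgroup_L by (rule subgroup.m_inv_closed)
    moreover have "inv a \<in> U" using a subgroup.m_inv_closed[OF subgroup_U] by simp
    ultimately show "v_type (?K Mod L) (quotient_le ?K le L) X"
      using a inv_K by (auto simp: v_type_def qo_equiv_def K.quotient_le_rcoset[OF N conv, simplified])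
  qed
  then show ?thesis using N conv by (simp add: normal_convex_valuational_def)
qed

lemma lower_group_least:
  assumes "normal_convex_valuational (G\<lparr>carrier := U\<rparr>) le N"
  shows "L \<subseteq> N"
proof
  let ?K = "G\<lparr>carrier := U\<rparr>"
  interpret K: C_qo_group ?K le by (rule C_qo_subgroup) (rule subgroup_U)
  have N: "N \<lhd> ?K" and conv: "convex_in (carrier ?K) le N"
    and val: "valuational (?K Mod N) (quotient_le ?K le N)"
    using assms by (auto simp: normal_convex_valuational_def)
  interpret N: normal N ?K by (rule N)
  have inv_K: "inv\<^bsub>?K\<^esub> x = inv x" if "x \<in> U" for x
    using that m_inv_consistent[OF subgroup_U] by simp
  \<comment> \<open>Outside \<open>N\<close> the quotient order is that of representatives, so a
    v-type coset of \<open>c\<close> would give \<open>c \<lesssim> inv c\<close>.\<close>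
  have o_plus: "c \<in> N" if c: "c \<in> L" "o_plus_type G le c" for c
  proof (rule ccontr)
    assume "c \<notin> N"
    have cU: "c \<in> U" using c by (simp add: upper_group_def)
    have mem: "N #>\<^bsub>?K\<^esub> c \<in> carrier (?K Mod N)" using cU by (auto simp: FactGroup_def RCOSETS_def)
    from valuational_imp_v_type[OF val mem]
    have "quotient_le ?K le N (N #>\<^bsub>?K\<^esub> c) (N #>\<^bsub>?K\<^esub> inv\<^bsub>?K\<^esub> c)"
      using N.inv_FactGroup[OF mem] N.rcos_inv cU by (simp add: v_type_def qo_equiv_def)
    then have "le c (inv c)"
      using K.quotient_le_rcoset[OF N conv] cU \<open>c \<notin> N\<close> inv_K subgroup.m_inv_closed[OF subgroup_U] by simp
    then show False using c o_plus_iff L_iff by blast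
  qed
  fix x assume x: "x \<in> L"
  have xc: "x \<in> carrier G" "x \<in> U" using x L_iff by (auto simp: upper_group_def)
  show "x \<in> N"
  proof (rule type_cases[OF xc(1)])
    assume v: "v_type G le x"
    show ?thesis
    proof (cases "x = \<one>")
      case True
      then show ?thesis using N.one_closed by simp
    next
      case False
      then obtain c where c: "c \<in> L" "o_plus_type G le c" "le x c"
        using v_type_in_L_below_o_plus x v by blast
      then have "c \<in> N" by (simp add: o_plus)
      moreover have "\<one> \<in> N" using N.one_closed by simp
      moreover have "x \<in> carrier ?K" using xc by simp
      \<comment> \<open>Convexity of \<open>N\<close> is applied to \<open>x\<close> between
        \<open>1\<close> and \<open>c\<close>.\<close>
      moreover have "\<one> \<lesssim> x \<and> x \<lesssim> c" using one_le xc c by blast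
      ultimately show ?thesis
        using conv[unfolded convex_in_def, THEN conjunct2, THEN bspec, THEN bspec, THEN bspec, THEN mp]
        by blast
    qed
  next
    assume "o_plus_type G le (inv x)"
    then have "inv x \<in> N" using o_plus subgroup.m_inv_closed[OF subgroup_L x] by simp
    then have "inv\<^bsub>?K\<^esub> (inv\<^bsub>?K\<^esub> x) \<in> N" using xc inv_K N.m_inv_closed by simp
    then show ?thesis using xc K.inv_inv[of x] by simp
  qed (use o_plus x in blast)
qed

end

end

theorem proposition3p30:
  fixes G :: "('a, 'm) monoid_scheme" and qle :: "'a \<Rightarrow> 'a \<Rightarrow> bool" and g :: 'a
  assumes "C_quasi_ordered_group G qle"
    and "g \<in> carrier G" and "g \<noteq> \<one>\<^bsub>G\<^esub>" and "v_type G qle g"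
  shows "normal_convex_valuational (G\<lparr>carrier := upper_group G qle g\<rparr>) qle (lower_group G qle g) \<and>
    (\<forall>N. normal_convex_valuational (G\<lparr>carrier := upper_group G qle g\<rparr>) qle N \<longrightarrow>
         lower_group G qle g \<subseteq> N)"
proof -
  interpret C_qo_group G qle using assms by (simp add: C_qo_group_iff)
  show ?thesis
    using lower_group_normal_convex_valuational lower_group_least assms by blast
qed

end
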